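(* Let $H$ be a complex Hilbert space and let $a, b \in E(H)$. Then $a$ is absolutely compatible with $b$ if and only if there exist $x, y, z, w \in E(H)$ such that $a = x + y$, $b = x + z$, $yz = 0 = xw$ and $x + y + z + w = I$.
   Context: $B(H)$ is the algebra of bounded linear operators on the complex Hilbert space $H$, $I$ is the identity operator, and $E(H) = \{a \in B(H) : a = a^*,\ 0 \le a \le I\}$ is the set of effects. For $u \in B(H)$, $|u| := (u^*u)^{1/2}$. For $a, b \in E(H)$, $a$ is said to be absolutely compatible with $b$ (written $a \triangle b$) if $|a - b| + |I - a - b| = I$. *)

theory Defs
  imports "HOL-Analysis.Analysis"
begin

(* The inner product is linear in the first argument. The real structure inherited from
   real_inner is forced to be the underlying one, so that the norm is the one induced by
   cinner; positive definiteness of cinner then follows from that of inner (see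
   cinner_self and cinner_self_eq_0_iff). *)
class complex_inner = real_inner +
  fixes scaleC :: "complex \<Rightarrow> 'a \<Rightarrow> 'a" (infixr \<open>*\<^sub>C\<close> 75)
    and cinner :: "'a \<Rightarrow> 'a \<Rightarrow> complex"
  assumes scaleC_add_right: "c *\<^sub>C (x + y) = c *\<^sub>C x + c *\<^sub>C y"
    and scaleC_add_left: "(c + d) *\<^sub>C x = c *\<^sub>C x + d *\<^sub>C x"
    and scaleC_scaleC: "c *\<^sub>C d *\<^sub>C x = (c * d) *\<^sub>C x"
    and scaleC_one: "1 *\<^sub>C x = x"
    and scaleR_eq_scaleC: "r *\<^sub>R x = complex_of_real r *\<^sub>C x"
    and cinner_commute: "cinner y x = cnj (cinner x y)"
    and cinner_add_left: "cinner (x + y) z = cinner x z + cinner y z"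
    and cinner_scaleC_left: "cinner (c *\<^sub>C x) y = c * cinner x y"
    and inner_eq_Re_cinner: "inner x y = Re (cinner x y)"

class complex_hilbert_space = complex_inner + complete_space

instantiation complex :: complex_hilbert_space
begin

definition scaleC_complex :: "complex \<Rightarrow> complex \<Rightarrow> complex"
  where "scaleC_complex c x = c * x"

definition cinner_complex :: "complex \<Rightarrow> complex \<Rightarrow> complex"
  where "cinner_complex x y = x * cnj y"

instance
  by standard
    (simp_all add: scaleC_complex_def cinner_complex_def inner_complex_def algebra_simps
      scaleR_conv_of_real)

end

lemma cinner_self: "cinner x x = complex_of_real ((norm x)\<^sup>2)"
  for x :: "'a::complex_inner"
proof (rule complex_eqI)
  show "Re (cinner x x) = Re (complex_of_real ((norm x)\<^sup>2))"
    by (simp add: inner_eq_Re_cinner [symmetric] power2_norm_eq_inner)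
  show "Im (cinner x x) = Im (complex_of_real ((norm x)\<^sup>2))"
    using arg_cong [OF cinner_commute [of x x], of Im] by simp
qed

lemma cinner_self_eq_0_iff: "cinner x x = 0 \<longleftrightarrow> x = 0"
  for x :: "'a::complex_inner"
  by (simp add: cinner_self)

(* B(H): the library type of bounded real-linear maps, cut down to the complex-linear ones.
   The product of operators is (o\<^sub>L) and the identity operator is id_blinfun. *)
definition bounded_ops :: "('a::complex_hilbert_space \<Rightarrow>\<^sub>L 'a) set"
  where "bounded_ops = {T. \<forall>c x. blinfun_apply T (c *\<^sub>C x) = c *\<^sub>C blinfun_apply T x}"

(* For T in B(H), existence is the Riesz representation theorem. *)
definition adj :: "('a::complex_hilbert_space \<Rightarrow>\<^sub>L 'a) \<Rightarrow> ('a \<Rightarrow>\<^sub>L 'a)"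
  where "adj T = (THE S. S \<in> bounded_ops \<and>
    (\<forall>x y. cinner (blinfun_apply T x) y = cinner x (blinfun_apply S y)))"

definition positive_op :: "('a::complex_hilbert_space \<Rightarrow>\<^sub>L 'a) \<Rightarrow> bool"
  where "positive_op T \<longleftrightarrow>
    T \<in> bounded_ops \<and> (\<forall>x. cinner (blinfun_apply T x) x \<in> \<real>\<^sub>\<ge>\<^sub>0)"

definition op_le :: "('a::complex_hilbert_space \<Rightarrow>\<^sub>L 'a) \<Rightarrow> ('a \<Rightarrow>\<^sub>L 'a) \<Rightarrow> bool"
  where "op_le S T \<longleftrightarrow> positive_op (T - S)"

definition effects :: "('a::complex_hilbert_space \<Rightarrow>\<^sub>L 'a) set"
  where "effects = {a \<in> bounded_ops. a = adj a \<and> op_le 0 a \<and> op_le a id_blinfun}"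

(* Meaningful for positive T, which has exactly one positive square root. *)
definition op_sqrt :: "('a::complex_hilbert_space \<Rightarrow>\<^sub>L 'a) \<Rightarrow> ('a \<Rightarrow>\<^sub>L 'a)"
  where "op_sqrt T = (THE S. positive_op S \<and> S o\<^sub>L S = T)"

definition op_abs :: "('a::complex_hilbert_space \<Rightarrow>\<^sub>L 'a) \<Rightarrow> ('a \<Rightarrow>\<^sub>L 'a)"
  where "op_abs u = op_sqrt (adj u o\<^sub>L u)"

definition abs_compatible :: "('a::complex_hilbert_space \<Rightarrow>\<^sub>L 'a) \<Rightarrow> ('a \<Rightarrow>\<^sub>L 'a) \<Rightarrow> bool"
    (infix \<open>\<triangle>\<close> 50)
  where "a \<triangle> b \<longleftrightarrow> op_abs (a - b) + op_abs (id_blinfun - a - b) = id_blinfun"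

end

theory Submission
  imports Defs
begin

text \<open>Put \<open>u = a - b\<close>, \<open>v = I - a - b\<close>. The four effects have to be the positive and negative
  parts \<open>y = u\<^sup>+\<close>, \<open>z = u\<^sup>-\<close>, \<open>w = v\<^sup>+\<close>, \<open>x = v\<^sup>-\<close>, and \<open>|u| + |v| = I\<close> is exactly what makes
  these parts recombine to \<open>a\<close>, \<open>b\<close> and \<open>I\<close>. Conversely \<open>y z = 0\<close> gives
  \<open>(y - z)\<^sup>2 = (y + z)\<^sup>2\<close>, so \<open>|a - b| = y + z\<close> by uniqueness of the positive square root, and
  likewise \<open>|I - a - b| = x + w\<close>.\<close>

text \<open>This makes the operator space a Banach space, where the series of square root iterates
  can be summed.\<close>

instance complex_hilbert_space \<subseteq> banach ..

section \<open>Complex-linear operators: algebra and limits\<close>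

lemma bounded_ops_scaleC: "T \<in> bounded_ops \<Longrightarrow> T (c *\<^sub>C x) = c *\<^sub>C T x"
  by (simp add: bounded_ops_def)

lemma scaleC_diff_right: "c *\<^sub>C (x - y) = c *\<^sub>C x - c *\<^sub>C y"
  for x y :: "'a::complex_inner"
  using scaleC_add_right [of c "x - y" y] by (simp add: algebra_simps)

lemma scaleR_scaleC_commute: "r *\<^sub>R c *\<^sub>C x = c *\<^sub>C r *\<^sub>R x"
  for x :: "'a::complex_inner"
  by (simp add: scaleR_eq_scaleC scaleC_scaleC mult.commute)

lemma bounded_ops_id: "id_blinfun \<in> bounded_ops"
  by (simp add: bounded_ops_def)

lemma bounded_ops_add: "S \<in> bounded_ops \<Longrightarrow> T \<in> bounded_ops \<Longrightarrow> S + T \<in> bounded_ops"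
  by (simp add: bounded_ops_def blinfun.bilinear_simps scaleC_add_right)

lemma bounded_ops_diff: "S \<in> bounded_ops \<Longrightarrow> T \<in> bounded_ops \<Longrightarrow> S - T \<in> bounded_ops"
  by (simp add: bounded_ops_def blinfun.bilinear_simps scaleC_diff_right)

lemma bounded_ops_scaleR: "T \<in> bounded_ops \<Longrightarrow> r *\<^sub>R T \<in> bounded_ops"
  by (simp add: bounded_ops_def blinfun.bilinear_simps scaleR_scaleC_commute)

lemma bounded_ops_compose: "S \<in> bounded_ops \<Longrightarrow> T \<in> bounded_ops \<Longrightarrow> S o\<^sub>L T \<in> bounded_ops"
  by (simp add: bounded_ops_def)

lemma norm_scaleC: "norm (c *\<^sub>C x) = cmod c * norm x"
  for x :: "'a::complex_inner"
proof -
  have "cinner (c *\<^sub>C x) (c *\<^sub>C x) = c * cnj (c * cinner x x)"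
    by (metis cinner_commute cinner_scaleC_left)
  then have "complex_of_real ((norm (c *\<^sub>C x))\<^sup>2) = complex_of_real ((cmod c * norm x)\<^sup>2)"
    by (simp add: cinner_self complex_norm_square [symmetric] power_mult_distrib
        flip: complex_norm_square mult.assoc)
  then have "(norm (c *\<^sub>C x))\<^sup>2 = (cmod c * norm x)\<^sup>2"
    using of_real_eq_iff by blast
  then show ?thesis
    by simp
qed

lemma tendsto_scaleC: "(f \<longlongrightarrow> l) F \<Longrightarrow> ((\<lambda>n. c *\<^sub>C f n) \<longlongrightarrow> c *\<^sub>C l) F"
  for l :: "'a::complex_inner"
proof -
  have "bounded_linear (\<lambda>x::'a. c *\<^sub>C x)"
    by (rule bounded_linear_intro [where K = "cmod c"])
      (simp_all add: scaleC_add_right scaleR_scaleC_commute norm_scaleC mult.commute)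
  then show "(f \<longlongrightarrow> l) F \<Longrightarrow> ((\<lambda>n. c *\<^sub>C f n) \<longlongrightarrow> c *\<^sub>C l) F"
    by (rule bounded_linear.tendsto)
qed

text \<open>Norm convergence gives pointwise convergence, and scaling by \<open>c\<close> is
  continuous. Needed for the limit of the square root iteration.\<close>

lemma bounded_ops_limit:
  assumes "\<And>n. Y n \<in> bounded_ops" and "Y \<longlonglongrightarrow> L"
  shows "L \<in> bounded_ops"
  unfolding bounded_ops_def
proof (intro CollectI allI)
  fix c x
  have ev: "(\<lambda>n. Y n v) \<longlonglongrightarrow> L v" for v
    using assms(2) by (intro blinfun.tendsto tendsto_const)
  have "(\<lambda>n. Y n (c *\<^sub>C x)) \<longlonglongrightarrow> c *\<^sub>C L x"
    using tendsto_scaleC [OF ev] by (simp add: bounded_ops_scaleC assms(1))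
  then show "L (c *\<^sub>C x) = c *\<^sub>C L x"
    using ev LIMSEQ_unique by blast
qed

section \<open>Self-adjointness and positivity\<close>

text \<open>Symmetry is asked only for the real inner product, so that later computations stay real;
  complex linearity lifts it to \<open>cinner\<close>.\<close>

definition self_adjoint_op :: "('a::complex_hilbert_space \<Rightarrow>\<^sub>L 'a) \<Rightarrow> bool"
  where "self_adjoint_op T \<longleftrightarrow> T \<in> bounded_ops \<and> (\<forall>x y. inner (T x) y = inner x (T y))"

lemma self_adjoint_opD: "self_adjoint_op T \<Longrightarrow> inner (T x) y = inner x (T y)"
  by (simp add: self_adjoint_op_def)

lemma cinner_scaleC_right: "cinner x (c *\<^sub>C y) = cnj c * cinner x y"
  by (metis cinner_commute cinner_scaleC_left complex_cnj_mult)

lemma Im_cinner: "Im (cinner x y) = inner x (\<i> *\<^sub>C y)"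
  by (simp add: inner_eq_Re_cinner cinner_scaleC_right)

text \<open>The imaginary part of \<open>cinner\<close> is a real inner product against i y, and
  \<open>T\<close> commutes with i.\<close>

lemma cinner_self_adjoint:
  assumes "self_adjoint_op T"
  shows "cinner (T x) y = cinner x (T y)"
proof (rule complex_eqI)
  show "Re (cinner (T x) y) = Re (cinner x (T y))"
    using assms by (simp add: self_adjoint_opD flip: inner_eq_Re_cinner)
  have "T (\<i> *\<^sub>C y) = \<i> *\<^sub>C T y"
    using assms by (simp add: self_adjoint_op_def bounded_ops_scaleC)
  then show "Im (cinner (T x) y) = Im (cinner x (T y))"
    using assms by (simp add: self_adjoint_opD Im_cinner)
qed

text \<open>Over the complex numbers a real-valued quadratic form already forces symmetry, by
  polarization.\<close>

lemma positive_op_iff: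
  "positive_op T \<longleftrightarrow> self_adjoint_op T \<and> (\<forall>x. 0 \<le> inner (T x) x)"
proof
  assume pos: "positive_op T"
  then have T: "T \<in> bounded_ops" and Im0: "Im (cinner (T x) x) = 0"
    and Re0: "0 \<le> Re (cinner (T x) x)" for x
    by (auto simp: positive_op_def complex_nonneg_Reals_iff)
  have "inner (T x) y = inner x (T y)" for x y
  proof -
    \<comment> \<open>Expanding the form at x + i y: its imaginary part vanishes at x, at i y and at
      their sum, so the imaginary parts of the cross terms cancel.\<close>
    let ?z = "\<i> *\<^sub>C y"
    have "Im (cinner (T (x + ?z)) (x + ?z)) = Im (cinner (T x) x) + Im (cinner (T ?z) ?z)
        + Im (cinner (T x) ?z) + Im (cinner (T ?z) x)"
      by (simp add: Im_cinner blinfun.bilinear_simps inner_add_left inner_add_right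
          scaleC_add_right)
    then have "Im (cinner (T x) ?z) + Im (cinner (T ?z) x) = 0"
      by (simp add: Im0)
    moreover have "Im (cinner (T x) ?z) = - inner (T x) y"
      by (simp add: cinner_scaleC_right inner_eq_Re_cinner)
    moreover have "Im (cinner (T ?z) x) = inner (T y) x"
      by (simp add: cinner_scaleC_left inner_eq_Re_cinner bounded_ops_scaleC T)
    ultimately show ?thesis
      by (simp add: inner_commute)
  qed
  then show "self_adjoint_op T \<and> (\<forall>x. 0 \<le> inner (T x) x)"
    using T Re0 by (simp add: self_adjoint_op_def inner_eq_Re_cinner)
next
  assume R: "self_adjoint_op T \<and> (\<forall>x. 0 \<le> inner (T x) x)"
  have "cinner (T x) x \<in> \<real>\<^sub>\<ge>\<^sub>0" for x
  proof -
    have "cnj (cinner (T x) x) = cinner (T x) x"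
      using R cinner_self_adjoint [of T x x] by (simp flip: cinner_commute)
    then have "Im (cinner (T x) x) = 0"
      by (simp add: complex_eq_iff)
    then show ?thesis
      using R by (simp add: complex_nonneg_Reals_iff inner_eq_Re_cinner)
  qed
  then show "positive_op T"
    using R by (simp add: positive_op_def self_adjoint_op_def)
qed

lemma positive_op_self_adjoint: "positive_op T \<Longrightarrow> self_adjoint_op T"
  by (simp add: positive_op_iff)

lemma positive_op_inner: "positive_op T \<Longrightarrow> 0 \<le> inner (T x) x"
  by (simp add: positive_op_iff)

text \<open>\<open>T\<close> meets the defining condition of its adjoint, and inner products against
  all x determine the value of a candidate at y.\<close>

lemma adj_self_adjoint:
  assumes "self_adjoint_op T"
  shows "adj T = T"
  unfolding adj_def
proof (rule the_equality)
  show "T \<in> bounded_ops \<and> (\<forall>x y. cinner (T x) y = cinner x (T y))"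
    using assms cinner_self_adjoint by (auto simp: self_adjoint_op_def)
next
  fix S
  assume S: "S \<in> bounded_ops \<and> (\<forall>x y. cinner (T x) y = cinner x (blinfun_apply S y))"
  show "S = T"
  proof (rule blinfun_eqI)
    fix y
    have "inner x (S y) = inner x (T y)" for x
      using S cinner_self_adjoint [OF assms, of x y] by (simp add: inner_eq_Re_cinner)
    then show "S y = T y"
      by (metis vector_eq_rdot inner_commute)
  qed
qed

section \<open>Algebra of self-adjoint and positive operators\<close>

lemma self_adjoint_id: "self_adjoint_op id_blinfun"
  by (simp add: self_adjoint_op_def bounded_ops_id)

lemma self_adjoint_add:
  "self_adjoint_op S \<Longrightarrow> self_adjoint_op T \<Longrightarrow> self_adjoint_op (S + T)"
  by (simp add: self_adjoint_op_def bounded_ops_add blinfun.bilinear_simps inner_simps)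

lemma self_adjoint_diff:
  "self_adjoint_op S \<Longrightarrow> self_adjoint_op T \<Longrightarrow> self_adjoint_op (S - T)"
  by (simp add: self_adjoint_op_def bounded_ops_diff blinfun.bilinear_simps inner_simps)

lemma self_adjoint_scaleR: "self_adjoint_op T \<Longrightarrow> self_adjoint_op (r *\<^sub>R T)"
  by (simp add: self_adjoint_op_def bounded_ops_scaleR blinfun.bilinear_simps)

lemma self_adjoint_square: "self_adjoint_op T \<Longrightarrow> self_adjoint_op (T o\<^sub>L T)"
  by (simp add: self_adjoint_op_def bounded_ops_compose)

lemma blinfun_compose_eqD: "S o\<^sub>L T = U o\<^sub>L V \<Longrightarrow> S (T x) = U (V x)"
  by (metis blinfun_apply_blinfun_compose)

lemma blinfun_compose_assoc: "(S o\<^sub>L T) o\<^sub>L U = S o\<^sub>L (T o\<^sub>L U)"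
  by (rule blinfun_eqI) simp

lemma self_adjoint_limit:
  assumes "\<And>n. self_adjoint_op (Y n)" and "Y \<longlonglongrightarrow> L"
  shows "self_adjoint_op L"
proof -
  have ev: "(\<lambda>n. Y n v) \<longlonglongrightarrow> L v" for v
    using assms(2) by (intro blinfun.tendsto tendsto_const)
  have "inner (L x) y = inner x (L y)" for x y
  proof (rule LIMSEQ_unique)
    show "(\<lambda>n. inner (Y n x) y) \<longlonglongrightarrow> inner (L x) y"
      by (intro tendsto_inner ev tendsto_const)
    show "(\<lambda>n. inner (Y n x) y) \<longlonglongrightarrow> inner x (L y)"
      unfolding self_adjoint_opD [OF assms(1)] by (intro tendsto_inner ev tendsto_const)
  qed
  then show ?thesis
    using assms bounded_ops_limit unfolding self_adjoint_op_def by blast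
qed

lemma positive_op_add: "positive_op S \<Longrightarrow> positive_op T \<Longrightarrow> positive_op (S + T)"
  by (simp add: positive_op_iff self_adjoint_add blinfun.bilinear_simps inner_simps)

lemma positive_op_scaleR: "positive_op T \<Longrightarrow> 0 \<le> r \<Longrightarrow> positive_op (r *\<^sub>R T)"
  by (simp add: positive_op_iff self_adjoint_scaleR blinfun.bilinear_simps)

lemma positive_op_square: "self_adjoint_op T \<Longrightarrow> positive_op (T o\<^sub>L T)"
  by (simp add: positive_op_iff self_adjoint_square) (metis self_adjoint_opD inner_ge_zero)

text \<open>Moving the outer \<open>D\<close> across the inner product turns the form at x into the
  form of \<open>P\<close> at \<open>D x\<close>.\<close>

lemma positive_op_conjugate:
  assumes "positive_op P" and "self_adjoint_op D"
  shows "positive_op (D o\<^sub>L P o\<^sub>L D)"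
proof -
  have "self_adjoint_op (D o\<^sub>L P o\<^sub>L D)"
    using assms by (simp add: positive_op_iff self_adjoint_op_def bounded_ops_compose)
  moreover have "inner ((D o\<^sub>L P o\<^sub>L D) x) x = inner (P (D x)) (D x)" for x
    using assms(2) by (simp add: self_adjoint_opD)
  ultimately show ?thesis
    using assms(1) by (simp add: positive_op_iff)
qed

section \<open>Criteria for an operator to vanish\<close>

lemma self_adjoint_square_eq_0:
  assumes "self_adjoint_op D" and "D o\<^sub>L D = 0"
  shows "D = 0"
proof (rule blinfun_eqI)
  fix x
  have "inner (D x) (D x) = inner x ((D o\<^sub>L D) x)"
    using assms(1) by (simp add: self_adjoint_opD)
  then show "D x = blinfun_apply 0 x"
    using assms(2) by simp
qed

text \<open>The fourth power vanishes too, so taking roots twice with the square criterion gives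
  first D^2 = 0, then D = 0.\<close>

lemma self_adjoint_cube_eq_0:
  assumes "self_adjoint_op D" and "D o\<^sub>L D o\<^sub>L D = 0"
  shows "D = 0"
proof -
  have "(D o\<^sub>L D) o\<^sub>L (D o\<^sub>L D) = 0"
    using assms(2) by (simp flip: blinfun_compose_assoc)
  then show ?thesis
    using assms(1) self_adjoint_square self_adjoint_square_eq_0 by blast
qed

text \<open>Polarization with second vector \<open>T x\<close>: the cross terms add up to twice the
  squared norm of \<open>T x\<close>.\<close>

lemma self_adjoint_form_eq_0:
  assumes "self_adjoint_op T" and "\<And>x. inner (T x) x = 0"
  shows "T = 0"
proof (rule blinfun_eqI)
  fix x
  have "inner (T (x + T x)) (x + T x) = 2 * inner (T x) (T x) + inner (T x) x
      + inner (T (T x)) (T x)"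
    using assms(1) by (simp add: blinfun.bilinear_simps inner_simps self_adjoint_opD)
  then show "T x = blinfun_apply 0 x"
    by (simp add: assms(2))
qed

lemma positive_op_add_eq_0:
  assumes "positive_op S" and "positive_op T" and "S + T = 0"
  shows "S = 0"
proof (rule self_adjoint_form_eq_0)
  show "self_adjoint_op S"
    using assms(1) by (rule positive_op_self_adjoint)
  show "inner (S x) x = 0" for x
  proof -
    have "inner (S x) x + inner (T x) x = inner ((S + T) x) x"
      by (simp add: blinfun.bilinear_simps inner_simps)
    then show ?thesis
      using assms positive_op_inner [of S x] positive_op_inner [of T x] by simp
  qed
qed

section \<open>Existence of positive square roots\<close>

lemma norm_le_1_if_between_0_id:
  assumes "positive_op A" and "positive_op (id_blinfun - A)"
  shows "norm A \<le> 1"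
proof (rule norm_blinfun_bound)
  fix x
  \<comment> \<open>Both summands are conjugates of positive operators, so A^2 \<le> A; hence |Ax|^2
    \<le> <Ax, x> \<le> |x|^2.\<close>
  have "A - (A o\<^sub>L A) = (A o\<^sub>L (id_blinfun - A) o\<^sub>L A)
      + ((id_blinfun - A) o\<^sub>L A o\<^sub>L (id_blinfun - A))"
    by (rule blinfun_eqI) (simp add: blinfun.bilinear_simps)
  then have "positive_op (A - (A o\<^sub>L A))"
    using assms by (metis positive_op_add positive_op_conjugate positive_op_self_adjoint)
  from positive_op_inner [OF this, of x]
  have "inner (A x) (A x) \<le> inner (A x) x"
    using assms by (simp add: blinfun.bilinear_simps inner_simps positive_op_iff self_adjoint_opD)
  also have "\<dots> \<le> inner x x"
    using positive_op_inner [OF assms(2), of x] by (simp add: blinfun.bilinear_simps inner_simps)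
  finally show "norm (A x) \<le> 1 * norm x"
    by (simp add: norm_le)
qed simp

text \<open>The solution \<open>Y\<close> of \<open>2 Y = A + Y\<^sup>2\<close>, for which \<open>(I - Y)\<^sup>2 = I - A\<close>,
  is found by iteration, dominated in norm by the same iteration for the number 1.\<close>

primrec sqrt_iter :: "('a::complex_hilbert_space \<Rightarrow>\<^sub>L 'a) \<Rightarrow> nat \<Rightarrow> ('a \<Rightarrow>\<^sub>L 'a)"
  where
    "sqrt_iter A 0 = 0"
  | "sqrt_iter A (Suc n) = (1/2) *\<^sub>R (A + (sqrt_iter A n o\<^sub>L sqrt_iter A n))"

primrec sqrt_iter_bound :: "nat \<Rightarrow> real"
  where
    "sqrt_iter_bound 0 = 0"
  | "sqrt_iter_bound (Suc n) = (1 + (sqrt_iter_bound n)\<^sup>2) / 2"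

lemma sqrt_iter_bound_range: "0 \<le> sqrt_iter_bound n \<and> sqrt_iter_bound n \<le> 1"
  by (induction n) (simp_all add: power_le_one)

lemma sqrt_iter_bound_mono: "sqrt_iter_bound n \<le> sqrt_iter_bound (Suc n)"
proof -
  \<comment> \<open>This square is twice the increment.\<close>
  have "0 \<le> (1 - sqrt_iter_bound n)\<^sup>2"
    by simp
  then show ?thesis
    by (simp add: power2_diff)
qed

lemma norm_sqrt_iter:
  assumes "norm A \<le> 1"
  shows "norm (sqrt_iter A n) \<le> sqrt_iter_bound n"
proof (induction n)
  case (Suc n)
  have "norm (sqrt_iter A n o\<^sub>L sqrt_iter A n) \<le> norm (sqrt_iter A n) * norm (sqrt_iter A n)"
    by (rule norm_blinfun_compose)
  also have "\<dots> \<le> (sqrt_iter_bound n)\<^sup>2"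
    using Suc by (simp add: power2_eq_square mult_mono sqrt_iter_bound_range)
  finally have "norm (A + (sqrt_iter A n o\<^sub>L sqrt_iter A n)) \<le> 1 + (sqrt_iter_bound n)\<^sup>2"
    using assms norm_triangle_le by (meson add_mono order_trans norm_triangle_ineq)
  then show ?case
    by simp
qed simp

lemma norm_sqrt_iter_diff:
  assumes "norm A \<le> 1"
  shows "norm (sqrt_iter A (Suc n) - sqrt_iter A n) \<le> sqrt_iter_bound (Suc n) - sqrt_iter_bound n"
proof (induction n)
  case 0
  then show ?case
    using assms by simp
next
  case (Suc n)
  let ?Y = "sqrt_iter A" and ?y = sqrt_iter_bound
  let ?D = "?Y (Suc n) - ?Y n"
  \<comment> \<open>The difference of squares is split as P^2 - Q^2 = P (P - Q) + (P - Q) Q, an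
    order valid for noncommuting factors; the scalar iteration satisfies the same identity.\<close>
  have "?Y (Suc (Suc n)) - ?Y (Suc n) = (1/2) *\<^sub>R ((?Y (Suc n) o\<^sub>L ?D) + (?D o\<^sub>L ?Y n))"
    using sqrt_iter.simps(2) [of A n] unfolding sqrt_iter.simps(2) [of A "Suc n"]
    by (intro blinfun_eqI) (simp add: blinfun.bilinear_simps algebra_simps del: sqrt_iter.simps)
  moreover have "norm (?Y (Suc n) o\<^sub>L ?D) \<le> ?y (Suc n) * (?y (Suc n) - ?y n)"
    using mult_mono [OF norm_sqrt_iter [OF assms, of "Suc n"] Suc]
    by (intro order_trans [OF norm_blinfun_compose])
      (simp add: sqrt_iter_bound_range del: sqrt_iter.simps sqrt_iter_bound.simps)
  moreover have "norm (?D o\<^sub>L ?Y n) \<le> (?y (Suc n) - ?y n) * ?y n"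
    using mult_mono [OF Suc norm_sqrt_iter [OF assms, of n]] sqrt_iter_bound_mono [of n]
    by (intro order_trans [OF norm_blinfun_compose])
      (simp del: sqrt_iter.simps sqrt_iter_bound.simps)
  ultimately have "norm (?Y (Suc (Suc n)) - ?Y (Suc n))
      \<le> (?y (Suc n) * (?y (Suc n) - ?y n) + (?y (Suc n) - ?y n) * ?y n) / 2"
    using norm_triangle_ineq [of "?Y (Suc n) o\<^sub>L ?D" "?D o\<^sub>L ?Y n"]
    by (simp del: sqrt_iter.simps sqrt_iter_bound.simps)
  also have "\<dots> = ?y (Suc (Suc n)) - ?y (Suc n)"
    using sqrt_iter_bound.simps(2) [of n] unfolding sqrt_iter_bound.simps(2) [of "Suc n"]
    by (simp add: power2_eq_square field_simps del: sqrt_iter_bound.simps)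
  finally show ?case .
qed

text \<open>The scalar iteration is increasing and bounded by 1, so its increments are summable;
  they dominate the operator increments, whose partial sums telescope to the iterates.\<close>

lemma sqrt_iter_convergent:
  assumes "norm A \<le> 1"
  shows "convergent (sqrt_iter A)"
proof -
  have "incseq sqrt_iter_bound"
    by (intro incseq_SucI sqrt_iter_bound_mono)
  then obtain l where "sqrt_iter_bound \<longlonglongrightarrow> l"
    using incseq_convergent [of sqrt_iter_bound 1] sqrt_iter_bound_range by blast
  then have "summable (\<lambda>n. sqrt_iter_bound (Suc n) - sqrt_iter_bound n)"
    by (rule telescope_summable)
  then have "summable (\<lambda>n. sqrt_iter A (Suc n) - sqrt_iter A n)"
    by (rule summable_comparison_test') (rule norm_sqrt_iter_diff [OF assms])
  then have "convergent (\<lambda>n. \<Sum>k<n. sqrt_iter A (Suc k) - sqrt_iter A k)"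
    by (simp only: summable_iff_convergent)
  then show ?thesis
    by (simp only: sum_lessThan_telescope) simp
qed

lemma sqrt_iter_self_adjoint: "self_adjoint_op A \<Longrightarrow> self_adjoint_op (sqrt_iter A n)"
proof (induction n)
  case 0
  then show ?case
    using self_adjoint_scaleR [of A 0] by simp
next
  case (Suc n)
  then show ?case
    by (simp add: self_adjoint_scaleR self_adjoint_add self_adjoint_square)
qed

lemma sqrt_iter_commute:
  assumes "C o\<^sub>L A = A o\<^sub>L C"
  shows "C o\<^sub>L sqrt_iter A n = sqrt_iter A n o\<^sub>L C"
proof (induction n)
  case 0
  then show ?case
    by (rule blinfun_eqI) (simp add: blinfun.bilinear_simps)
next
  case (Suc n)
  have A: "C (A x) = A (C x)" for x
    using assms by (rule blinfun_compose_eqD)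
  have "C (sqrt_iter A n x) = sqrt_iter A n (C x)" for x
    using Suc by (rule blinfun_compose_eqD)
  then show ?case
    by (intro blinfun_eqI) (simp add: blinfun.bilinear_simps A)
qed

text \<open>The root is I - Y with Y the limit of the iteration for I - T. Commutation with
  everything that commutes with \<open>T\<close> is recorded because uniqueness of the root rests on
  it.\<close>

lemma sqrt_exists_contraction:
  assumes T: "positive_op T" "positive_op (id_blinfun - T)"
  obtains R where "positive_op R" "R o\<^sub>L R = T"
    "\<And>C. C o\<^sub>L T = T o\<^sub>L C \<Longrightarrow> C o\<^sub>L R = R o\<^sub>L C"
proof -
  define A where "A = id_blinfun - T"
  have A: "positive_op A" "norm A \<le> 1"
    using assms norm_le_1_if_between_0_id [of A] by (simp_all add: A_def)
  obtain Y where Y: "sqrt_iter A \<longlonglongrightarrow> Y"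
    using sqrt_iter_convergent [OF A(2)] by (auto simp: convergent_def)
  have fixpoint: "Y = (1/2) *\<^sub>R (A + (Y o\<^sub>L Y))"
  proof (rule LIMSEQ_unique)
    show "(\<lambda>n. sqrt_iter A (Suc n)) \<longlonglongrightarrow> Y"
      using Y by (rule LIMSEQ_Suc)
    show "(\<lambda>n. sqrt_iter A (Suc n)) \<longlonglongrightarrow> (1/2) *\<^sub>R (A + (Y o\<^sub>L Y))"
      unfolding sqrt_iter.simps
      by (intro tendsto_intros bounded_bilinear.tendsto [OF bounded_bilinear_blinfun_compose] Y)
  qed
  have sa: "self_adjoint_op Y"
    using sqrt_iter_self_adjoint positive_op_self_adjoint A(1) Y self_adjoint_limit by blast
  have "norm (sqrt_iter A n) \<le> 1" for n
    using norm_sqrt_iter [OF A(2), of n] sqrt_iter_bound_range [of n] by linarith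
  then have normY: "norm Y \<le> 1"
    using LIMSEQ_le_const2 [OF tendsto_norm [OF Y]] by blast
  show thesis
  proof
    \<comment> \<open>By Cauchy-Schwarz the norm bound 1 on Y gives Y \<le> I, hence positivity of
      the root.\<close>
    have "inner (Y x) x \<le> inner x x" for x
    proof -
      have "inner (Y x) x \<le> norm (Y x) * norm x"
        by (rule norm_cauchy_schwarz)
      also have "\<dots> \<le> norm x * norm x"
        using norm_blinfun [of Y x] mult_right_mono [OF normY, of "norm x"]
        by (intro mult_right_mono) simp_all
      finally show ?thesis
        by (simp add: power2_eq_square flip: power2_norm_eq_inner)
    qed
    then show "positive_op (id_blinfun - Y)"
      by (simp add: positive_op_iff self_adjoint_diff self_adjoint_id sa blinfun.bilinear_simps
          inner_simps)
    show "(id_blinfun - Y) o\<^sub>L (id_blinfun - Y) = T"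
    proof (rule blinfun_eqI)
      fix x
      have "2 *\<^sub>R Y x = 2 *\<^sub>R ((1/2) *\<^sub>R (A + (Y o\<^sub>L Y))) x"
        using fixpoint by simp
      then have "Y x + Y x = x - T x + Y (Y x)"
        by (simp add: A_def blinfun.bilinear_simps scaleR_2)
      then show "((id_blinfun - Y) o\<^sub>L (id_blinfun - Y)) x = T x"
        by (simp add: blinfun.bilinear_simps algebra_simps)
    qed
  next
    fix C
    assume C: "C o\<^sub>L T = T o\<^sub>L C"
    have "C (T x) = T (C x)" for x
      using C by (rule blinfun_compose_eqD)
    then have "C o\<^sub>L A = A o\<^sub>L C"
      by (intro blinfun_eqI) (simp add: A_def blinfun.bilinear_simps)
    then have eq: "C o\<^sub>L sqrt_iter A n = sqrt_iter A n o\<^sub>L C" for n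
      by (rule sqrt_iter_commute)
    \<comment> \<open>The iterates are built from \<open>A\<close> alone, so each commutes with
      \<open>C\<close>, and composition is continuous.\<close>
    have "C o\<^sub>L Y = Y o\<^sub>L C"
    proof (rule LIMSEQ_unique)
      show "(\<lambda>n. C o\<^sub>L sqrt_iter A n) \<longlonglongrightarrow> (C o\<^sub>L Y)"
        by (intro tendsto_intros bounded_bilinear.tendsto [OF bounded_bilinear_blinfun_compose] Y)
      show "(\<lambda>n. C o\<^sub>L sqrt_iter A n) \<longlonglongrightarrow> (Y o\<^sub>L C)"
        unfolding eq
        by (intro tendsto_intros bounded_bilinear.tendsto [OF bounded_bilinear_blinfun_compose] Y)
    qed
    then have "C (Y x) = Y (C x)" for x
      by (rule blinfun_compose_eqD)
    then show "C o\<^sub>L (id_blinfun - Y) = (id_blinfun - Y) o\<^sub>L C"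
      by (intro blinfun_eqI) (simp add: blinfun.bilinear_simps)
  qed
qed

lemma sqrt_exists:
  assumes T: "positive_op T"
  obtains R where "positive_op R" "R o\<^sub>L R = T"
    "\<And>C. C o\<^sub>L T = T o\<^sub>L C \<Longrightarrow> C o\<^sub>L R = R o\<^sub>L C"
proof -
  \<comment> \<open>Dividing by r brings \<open>T\<close> between 0 and I; the added 1 keeps r
    positive even for T = 0.\<close>
  define r where "r = norm T + 1"
  have r: "r > 0"
    by (simp add: r_def add_nonneg_pos)
  define T' where "T' = (1/r) *\<^sub>R T"
  have "inner (T x) x \<le> r * inner x x" for x
  proof -
    have "inner (T x) x \<le> norm (T x) * norm x"
      by (rule norm_cauchy_schwarz)
    also have "\<dots> \<le> (norm T * norm x) * norm x"
      by (intro mult_right_mono norm_blinfun) simp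
    also have "\<dots> \<le> r * (norm x * norm x)"
      by (simp add: r_def algebra_simps)
    finally show ?thesis
      by (simp add: power2_eq_square flip: power2_norm_eq_inner)
  qed
  then have "positive_op (id_blinfun - T')"
    using T r
    by (simp add: positive_op_iff self_adjoint_diff self_adjoint_id self_adjoint_scaleR T'_def
        blinfun.bilinear_simps inner_simps field_simps)
  moreover have "positive_op T'"
    using T r by (simp add: T'_def positive_op_scaleR)
  ultimately obtain R where R: "positive_op R" "R o\<^sub>L R = T'"
    "\<And>C. C o\<^sub>L T' = T' o\<^sub>L C \<Longrightarrow> C o\<^sub>L R = R o\<^sub>L C"
    using sqrt_exists_contraction by blast
  show thesis
  proof
    show "positive_op (sqrt r *\<^sub>R R)"
      using R(1) r by (simp add: positive_op_scaleR)
    have "(sqrt r *\<^sub>R R) o\<^sub>L (sqrt r *\<^sub>R R) = r *\<^sub>R (R o\<^sub>L R)"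
      using r by (intro blinfun_eqI) (simp add: blinfun.bilinear_simps)
    then show "(sqrt r *\<^sub>R R) o\<^sub>L (sqrt r *\<^sub>R R) = T"
      using r by (simp add: R(2) T'_def)
  next
    fix C
    assume "C o\<^sub>L T = T o\<^sub>L C"
    then have "C (T x) = T (C x)" for x
      by (rule blinfun_compose_eqD)
    then have "C o\<^sub>L T' = T' o\<^sub>L C"
      by (intro blinfun_eqI) (simp add: T'_def blinfun.bilinear_simps)
    then have "C (R x) = R (C x)" for x
      by (intro blinfun_compose_eqD R(3))
    then show "C o\<^sub>L (sqrt r *\<^sub>R R) = (sqrt r *\<^sub>R R) o\<^sub>L C"
      by (intro blinfun_eqI) (simp add: blinfun.bilinear_simps)
  qed
qed

section \<open>Uniqueness of the root and the absolute value\<close>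

text \<open>With D = R - S, commutation gives (R + S) D = R^2 - S^2 = 0. So the positive operators
  DRD and DSD sum to 0, both vanish, and D^3 is their difference.\<close>

lemma commuting_sqrt_unique:
  assumes "positive_op R" "positive_op S" "R o\<^sub>L R = S o\<^sub>L S" "R o\<^sub>L S = S o\<^sub>L R"
  shows "R = S"
proof -
  let ?D = "R - S"
  have D: "self_adjoint_op ?D"
    using assms by (simp add: self_adjoint_diff positive_op_self_adjoint)
  have sq: "R (R x) = S (S x)" and comm: "R (S x) = S (R x)" for x
    using assms(3,4) by (auto dest: blinfun_compose_eqD)
  have sum: "(?D o\<^sub>L R o\<^sub>L ?D) + (?D o\<^sub>L S o\<^sub>L ?D) = 0"
    by (rule blinfun_eqI) (simp add: blinfun.bilinear_simps sq comm)
  have "?D o\<^sub>L R o\<^sub>L ?D = 0"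
    by (rule positive_op_add_eq_0 [OF positive_op_conjugate positive_op_conjugate])
      (fact assms D sum)+
  moreover from this have "?D o\<^sub>L S o\<^sub>L ?D = 0"
    using sum by simp
  moreover have "?D o\<^sub>L ?D o\<^sub>L ?D = (?D o\<^sub>L R o\<^sub>L ?D) - (?D o\<^sub>L S o\<^sub>L ?D)"
    by (rule blinfun_eqI) (simp add: blinfun.bilinear_simps)
  ultimately have "?D o\<^sub>L ?D o\<^sub>L ?D = 0"
    by simp
  then show ?thesis
    using self_adjoint_cube_eq_0 [OF D] by simp
qed

lemma op_sqrt_unique:
  assumes "positive_op S" and "S o\<^sub>L S = T"
  shows "op_sqrt T = S"
proof -
  have "positive_op T"
    using assms positive_op_square positive_op_self_adjoint by blast
  then obtain R where R: "positive_op R" "R o\<^sub>L R = T"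
    "\<And>C. C o\<^sub>L T = T o\<^sub>L C \<Longrightarrow> C o\<^sub>L R = R o\<^sub>L C"
    using sqrt_exists by blast
  have eq: "S' = R" if "positive_op S'" "S' o\<^sub>L S' = T" for S'
  proof -
    \<comment> \<open>Any root commutes with its own square \<open>T\<close>, hence with the
      constructed root \<open>R\<close>, which reduces uniqueness to the commuting case.\<close>
    have "S' o\<^sub>L T = T o\<^sub>L S'"
      by (simp add: that(2) [symmetric] blinfun_compose_assoc)
    then have "S' o\<^sub>L R = R o\<^sub>L S'"
      by (rule R(3))
    then show ?thesis
      by (rule commuting_sqrt_unique [OF that(1) R(1), rotated]) (simp only: that(2) R(2))
  qed
  then show ?thesis
    unfolding op_sqrt_def using assms by (intro the_equality) (auto dest: eq)
qed

lemma op_abs_unique: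
  assumes "self_adjoint_op u" "positive_op S" "S o\<^sub>L S = u o\<^sub>L u"
  shows "op_abs u = S"
  using assms by (simp add: op_abs_def adj_self_adjoint op_sqrt_unique)

lemma
  assumes "self_adjoint_op u"
  shows op_abs_positive: "positive_op (op_abs u)"
    and op_abs_square: "op_abs u o\<^sub>L op_abs u = u o\<^sub>L u"
    and op_abs_commute_if: "C o\<^sub>L (u o\<^sub>L u) = (u o\<^sub>L u) o\<^sub>L C \<Longrightarrow> C o\<^sub>L op_abs u = op_abs u o\<^sub>L C"
proof -
  obtain R where R: "positive_op R" "R o\<^sub>L R = u o\<^sub>L u"
    and comm: "\<And>C. C o\<^sub>L (u o\<^sub>L u) = (u o\<^sub>L u) o\<^sub>L C \<Longrightarrow> C o\<^sub>L R = R o\<^sub>L C"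
    by (rule sqrt_exists [OF positive_op_square [OF assms]]) iprover
  have eq: "op_abs u = R"
    using assms R by (rule op_abs_unique)
  show "positive_op (op_abs u)"
    using R(1) by (simp only: eq)
  show "op_abs u o\<^sub>L op_abs u = u o\<^sub>L u"
    using R(2) by (simp only: eq)
  assume "C o\<^sub>L (u o\<^sub>L u) = (u o\<^sub>L u) o\<^sub>L C"
  then have "C o\<^sub>L R = R o\<^sub>L C"
    by (rule comm)
  then show "C o\<^sub>L op_abs u = op_abs u o\<^sub>L C"
    by (simp only: eq)
qed

text \<open>With \<open>M = |m|\<close> and \<open>d = M - m\<close> everything commutes and \<open>2 m\<^sup>2 d\<close> equals both
  \<open>d M d\<close> and \<open>- d p d\<close>, so that \<open>m\<^sup>2 d = 0\<close>, while \<open>d\<^sup>3 = 4 m\<^sup>2 d\<close>.\<close>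

lemma positive_op_if_square_eq_mult:
  assumes m: "self_adjoint_op m" and p: "positive_op p"
    and comm: "p o\<^sub>L m = m o\<^sub>L p" and sq: "m o\<^sub>L m = p o\<^sub>L m"
  shows "positive_op m"
proof -
  define M where "M = op_abs m"
  define d where "d = M - m"
  have M: "positive_op M" "M o\<^sub>L M = m o\<^sub>L m"
    unfolding M_def using m by (rule op_abs_positive op_abs_square)+
  have "m o\<^sub>L M = M o\<^sub>L m"
    unfolding M_def by (intro op_abs_commute_if m) (simp add: blinfun_compose_assoc)
  moreover have "p o\<^sub>L M = M o\<^sub>L p"
    unfolding M_def using blinfun_compose_eqD [OF comm]
    by (intro op_abs_commute_if m blinfun_eqI) simp
  ultimately have commM: "m (M x) = M (m x)" "p (M x) = M (p x)" for x
    by (auto dest: blinfun_compose_eqD)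
  have MM: "M (M x) = p (m x)" and mm: "m (m x) = p (m x)" and mp: "m (p x) = p (m x)" for x
    using blinfun_compose_eqD [OF M(2)] blinfun_compose_eqD [OF sq] blinfun_compose_eqD [OF comm]
    by simp_all
  have d: "self_adjoint_op d"
    using m M(1) by (simp add: d_def self_adjoint_diff positive_op_self_adjoint)
  have "(d o\<^sub>L M o\<^sub>L d) + (d o\<^sub>L p o\<^sub>L d) = 0"
    by (rule blinfun_eqI)
      (simp add: d_def blinfun.bilinear_simps commM MM mm mp scaleR_2)
  moreover have "positive_op (d o\<^sub>L M o\<^sub>L d)" "positive_op (d o\<^sub>L p o\<^sub>L d)"
    using M(1) p d by (simp_all add: positive_op_conjugate)
  ultimately have "d o\<^sub>L M o\<^sub>L d = 0"
    using positive_op_add_eq_0 by blast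
  moreover have "d o\<^sub>L d o\<^sub>L d = 2 *\<^sub>R (d o\<^sub>L M o\<^sub>L d)"
    by (rule blinfun_eqI)
      (simp add: d_def blinfun.bilinear_simps commM MM mm mp scaleR_2)
  ultimately have "d = 0"
    using self_adjoint_cube_eq_0 [OF d] by simp
  then show ?thesis
    using M(1) by (simp add: d_def)
qed

section \<open>Positive and negative parts\<close>

lemma op_abs_commute:
  assumes "self_adjoint_op u"
  shows "u o\<^sub>L op_abs u = op_abs u o\<^sub>L u"
  by (intro op_abs_commute_if assms) (simp add: blinfun_compose_assoc)

text \<open>The criterion applies to m = |u| - u with p = 2|u|: since |u|^2 = u^2 and the two
  commute, m^2 = 2u^2 - 2|u|u = p m.\<close>

lemma op_abs_minus_positive:
  assumes u: "self_adjoint_op u"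
  shows "positive_op (op_abs u - u)"
proof (rule positive_op_if_square_eq_mult [where p = "op_abs u + op_abs u"])
  note P = op_abs_positive [OF u] op_abs_square [OF u]
  show "self_adjoint_op (op_abs u - u)" "positive_op (op_abs u + op_abs u)"
    using P(1) u by (simp_all add: self_adjoint_diff positive_op_self_adjoint positive_op_add)
  have eqs: "u (op_abs u x) = op_abs u (u x)" "op_abs u (op_abs u x) = u (u x)" for x
    by (intro blinfun_compose_eqD op_abs_commute u P(2))+
  show "(op_abs u + op_abs u) o\<^sub>L (op_abs u - u) = (op_abs u - u) o\<^sub>L (op_abs u + op_abs u)"
    by (rule blinfun_eqI) (simp add: blinfun.bilinear_simps eqs)
  show "(op_abs u - u) o\<^sub>L (op_abs u - u) = (op_abs u + op_abs u) o\<^sub>L (op_abs u - u)"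
    by (rule blinfun_eqI) (simp add: blinfun.bilinear_simps eqs)
qed

lemma op_abs_uminus: "self_adjoint_op u \<Longrightarrow> op_abs (- u) = op_abs u"
  using self_adjoint_scaleR [of u "-1"]
  by (simp add: op_abs_def adj_self_adjoint
      bounded_bilinear.minus_left [OF bounded_bilinear_blinfun_compose]
      bounded_bilinear.minus_right [OF bounded_bilinear_blinfun_compose])

text \<open>The previous positivity result for -u, which has the same absolute value.\<close>

lemma op_abs_plus_positive:
  assumes "self_adjoint_op u"
  shows "positive_op (op_abs u + u)"
  using op_abs_minus_positive [of "- u"] self_adjoint_scaleR [of u "-1"] assms
  by (simp add: op_abs_uminus)

text \<open>As |u| and u commute, both products are |u|^2 - u^2.\<close>

lemma op_abs_parts_orthogonal:
  assumes "self_adjoint_op u"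
  shows "(op_abs u + u) o\<^sub>L (op_abs u - u) = 0" "(op_abs u - u) o\<^sub>L (op_abs u + u) = 0"
proof -
  have eqs: "u (op_abs u x) = op_abs u (u x)" "op_abs u (op_abs u x) = u (u x)" for x
    by (intro blinfun_compose_eqD op_abs_commute op_abs_square assms)+
  show "(op_abs u + u) o\<^sub>L (op_abs u - u) = 0" "(op_abs u - u) o\<^sub>L (op_abs u + u) = 0"
    by (auto intro: blinfun_eqI simp: blinfun.bilinear_simps eqs)
qed

text \<open>This is the adjoint of the hypothesis, obtained from |zyv|^2 = <v, yz(zyv)> = 0.\<close>

lemma self_adjoint_orthogonal_commute:
  assumes "self_adjoint_op y" "self_adjoint_op z" "y o\<^sub>L z = 0"
  shows "z o\<^sub>L y = 0"
proof (rule blinfun_eqI)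
  fix v
  have "inner (z (y v)) (z (y v)) = inner v ((y o\<^sub>L z) (z (y v)))"
    using assms(1,2) by (simp add: self_adjoint_opD)
  then show "(z o\<^sub>L y) v = blinfun_apply 0 v"
    using assms(3) by simp
qed

lemma op_abs_orthogonal_diff:
  assumes "positive_op y" "positive_op z" "y o\<^sub>L z = 0"
  shows "op_abs (y - z) = y + z"
proof (rule op_abs_unique)
  show "self_adjoint_op (y - z)" "positive_op (y + z)"
    using assms by (simp_all add: self_adjoint_diff positive_op_self_adjoint positive_op_add)
  have "z o\<^sub>L y = 0"
    using assms self_adjoint_orthogonal_commute positive_op_self_adjoint by blast
  then have "y (z v) = 0" "z (y v) = 0" for v
    using assms(3) by (simp_all flip: blinfun_apply_blinfun_compose)
  then show "(y + z) o\<^sub>L (y + z) = (y - z) o\<^sub>L (y - z)"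
    by (intro blinfun_eqI) (simp add: blinfun.bilinear_simps)
qed

section \<open>Effects and the equivalence\<close>

text \<open>The condition a = \<open>adj a\<close> is absorbed, since positivity already entails
  self-adjointness.\<close>

lemma effects_iff: "a \<in> effects \<longleftrightarrow> positive_op a \<and> positive_op (id_blinfun - a)"
  by (auto simp: effects_def op_le_def positive_op_iff adj_self_adjoint self_adjoint_op_def)

theorem corollary3p2:
  fixes a b :: "'a::complex_hilbert_space \<Rightarrow>\<^sub>L 'a"
  assumes "a \<in> effects" and "b \<in> effects"
  shows "a \<triangle> b \<longleftrightarrow>
    (\<exists>x\<in>effects. \<exists>y\<in>effects. \<exists>z\<in>effects. \<exists>w\<in>effects.
      a = x + y \<and> b = x + z \<and> y o\<^sub>L z = 0 \<and> 0 = x o\<^sub>L w \<and>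
      x + y + z + w = id_blinfun)"
proof
  assume compat: "a \<triangle> b"
  define u v where "u = a - b" and "v = id_blinfun - a - b"
  have sa: "self_adjoint_op u" "self_adjoint_op v"
    using assms
    by (simp_all add: u_def v_def effects_iff self_adjoint_diff self_adjoint_id
        positive_op_self_adjoint)
  define y z w x where "y = (1/2) *\<^sub>R (op_abs u + u)" and "z = (1/2) *\<^sub>R (op_abs u - u)"
    and "w = (1/2) *\<^sub>R (op_abs v + v)" and "x = (1/2) *\<^sub>R (op_abs v - v)"
  have pos: "positive_op x" "positive_op y" "positive_op z" "positive_op w"
    using sa by (simp_all add: x_def y_def z_def w_def positive_op_scaleR op_abs_minus_positive
        op_abs_plus_positive)
  \<comment> \<open>Compatibility enters here only: it eliminates |v|, so all four parts become
    expressions in |u|, a, b and I, in whose relevant sums |u| cancels.\<close>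
  have abs_v: "op_abs v = id_blinfun - op_abs u"
    using compat by (simp add: abs_compatible_def u_def v_def algebra_simps)
  have half: "(1/2) *\<^sub>R T + (1/2) *\<^sub>R T = T" for T :: "'a \<Rightarrow>\<^sub>L 'a"
    by (simp flip: scaleR_add_left)
  have a: "a = x + y"
    using half [of a] unfolding x_def y_def abs_v unfolding u_def v_def
    by (simp add: scaleR_add_right scaleR_diff_right algebra_simps)
  have b: "b = x + z"
    using half [of b] unfolding x_def z_def abs_v unfolding u_def v_def
    by (simp add: scaleR_add_right scaleR_diff_right algebra_simps)
  have "z + w = id_blinfun - a"
    using half [of a] half [of id_blinfun] unfolding w_def z_def abs_v unfolding u_def v_def
    by (simp add: scaleR_add_right scaleR_diff_right algebra_simps)
  then have sum: "x + y + z + w = id_blinfun"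
    using a by (simp add: algebra_simps)
  \<comment> \<open>The complement of each part is the sum of the other three, so positivity of all
    four makes them effects.\<close>
  have eqs: "id_blinfun - x = y + z + w" "id_blinfun - y = x + z + w"
    "id_blinfun - z = x + y + w" "id_blinfun - w = x + y + z"
    using sum by (simp_all add: algebra_simps)
  have "x \<in> effects" "y \<in> effects" "z \<in> effects" "w \<in> effects"
    unfolding effects_iff eqs using pos by (simp_all add: positive_op_add)
  moreover have "y o\<^sub>L z = 0" "0 = x o\<^sub>L w"
    using op_abs_parts_orthogonal [OF sa(1)] op_abs_parts_orthogonal [OF sa(2)]
    by (simp_all add: x_def y_def z_def w_def
        bounded_bilinear.scaleR_left [OF bounded_bilinear_blinfun_compose]
        bounded_bilinear.scaleR_right [OF bounded_bilinear_blinfun_compose])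
  ultimately show "\<exists>x\<in>effects. \<exists>y\<in>effects. \<exists>z\<in>effects. \<exists>w\<in>effects.
      a = x + y \<and> b = x + z \<and> y o\<^sub>L z = 0 \<and> 0 = x o\<^sub>L w \<and>
      x + y + z + w = id_blinfun"
    using a b sum by blast
next
  assume "\<exists>x\<in>effects. \<exists>y\<in>effects. \<exists>z\<in>effects. \<exists>w\<in>effects.
      a = x + y \<and> b = x + z \<and> y o\<^sub>L z = 0 \<and> 0 = x o\<^sub>L w \<and>
      x + y + z + w = id_blinfun"
  then obtain x y z w
    where eff: "x \<in> effects" "y \<in> effects" "z \<in> effects" "w \<in> effects"
      and ab: "a = x + y" "b = x + z" and orth: "y o\<^sub>L z = 0" "0 = x o\<^sub>L w"
      and sum: "x + y + z + w = id_blinfun"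
    by blast
  have pos: "positive_op x" "positive_op y" "positive_op z" "positive_op w"
    using eff by (simp_all add: effects_iff)
  \<comment> \<open>The order is reversed because I - a - b is w - x, with \<open>w\<close> as the
    positive part.\<close>
  have "w o\<^sub>L x = 0"
    using pos orth(2) [symmetric] self_adjoint_orthogonal_commute positive_op_self_adjoint by blast
  then have "op_abs (w - x) = w + x" "op_abs (y - z) = y + z"
    using pos orth(1) by (simp_all add: op_abs_orthogonal_diff)
  moreover have "a - b = y - z" "id_blinfun - a - b = w - x"
    by (simp_all add: ab flip: sum)
  ultimately show "a \<triangle> b"
    using sum by (simp add: abs_compatible_def ac_simps)
qed

end
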